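(* Let $A\in\mathbb{R}^{n\times n}$ be symmetric positive semidefinite and let $f:[0,\infty)\to\mathbb{R}$ be nondecreasing. Let $1\le s\le n$, and for any subset $S\subset\{1,\dots,n\}$ with $|S|=s$ define $$X(S):=\frac{n}{s}\,\operatorname{tr}\bigl(f(A)_S\bigr).$$ If $S$ is drawn uniformly at random from all subsets of $\{1,\dots,n\}$ of size $s$, then $\mathbb{E}_S[X(S)]=\operatorname{tr}(f(A))$.
   Context: For a symmetric positive semidefinite matrix $A=Q\,\mathrm{diag}(\lambda_1,\dots,\lambda_n)\,Q^T$ with $Q$ orthogonal, $f(A):=Q\,\mathrm{diag}(f(\lambda_1),\dots,f(\lambda_n))\,Q^T$. For an $n\times n$ matrix $M$ and $S\subset\{1,\dots,n\}$, $M_S=M(S,S)$ denotes the principal submatrix of $M$ with rows and columns indexed by $S$; thus $f(A)_S$ is the principal submatrix of $f(A)$ (not $f$ applied to the submatrix $A_S$). *)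

theory Defs
  imports
    "HOL-Probability.Probability_Mass_Function"
    "Jordan_Normal_Form.Determinant"
    "Jordan_Normal_Form.DL_Submatrix"
begin

text \<open>
  Matrices of size \<open>n \<times> n\<close> are elements of \<open>carrier_mat n n\<close>, so rows and columns are indexed
  by \<open>{0..<n}\<close> rather than by \<open>{1..n}\<close>. For \<open>S \<subseteq> {0..<n}\<close> the principal submatrix \<open>M(S,S)\<close>, itself
  a matrix of size \<open>card S\<close>, is \<open>submatrix M S S\<close>.
\<close>

definition trace_mat :: "'a::comm_monoid_add mat \<Rightarrow> 'a" where
  "trace_mat A = (\<Sum>i = 0..<dim_row A. A $$ (i, i))"

definition psd_mat :: "nat \<Rightarrow> real mat \<Rightarrow> bool" where
  "psd_mat n A \<longleftrightarrow> A \<in> carrier_mat n n \<and> transpose_mat A = A \<and>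
     (\<forall>v \<in> carrier_vec n. 0 \<le> v \<bullet> (A *\<^sub>v v))"

definition real_orthogonal_mat :: "nat \<Rightarrow> real mat \<Rightarrow> bool" where
  "real_orthogonal_mat n Q \<longleftrightarrow> Q \<in> carrier_mat n n \<and> transpose_mat Q * Q = 1\<^sub>m n"
  \<comment> \<open>The library's \<open>orthogonal_mat\<close> only asks for pairwise orthogonal, non-zero columns, without
     normalisation.\<close>

definition spectral_decomp :: "real mat \<Rightarrow> real mat \<Rightarrow> (nat \<Rightarrow> real) \<Rightarrow> bool" where
  "spectral_decomp A Q l \<longleftrightarrow>
     real_orthogonal_mat (dim_row A) Q \<and> A = Q * mat_diag (dim_row A) l * transpose_mat Q"

definition mat_fun :: "(real \<Rightarrow> real) \<Rightarrow> real mat \<Rightarrow> real mat" where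
  "mat_fun f A = (THE B. \<exists>Q l. spectral_decomp A Q l \<and>
     B = Q * mat_diag (dim_row A) (\<lambda>i. f (l i)) * transpose_mat Q)"

text \<open>
  Every real symmetric matrix has a spectral decomposition; the two lemmas below show that the
  value of \<open>mat_fun f A\<close> does not depend on which one is used, and that for positive semidefinite
  \<open>A\<close> only the values of \<open>f\<close> on \<open>{0..}\<close> matter.
\<close>

lemma real_orthogonal_matD:
  assumes "real_orthogonal_mat n Q"
  shows "Q \<in> carrier_mat n n" "transpose_mat Q \<in> carrier_mat n n"
    "transpose_mat Q * Q = 1\<^sub>m n" "Q * transpose_mat Q = 1\<^sub>m n"
  using assms mat_mult_left_right_inverse[of "transpose_mat Q" n Q]
  by (auto simp: real_orthogonal_mat_def)

lemma real_orthogonal_mat_cancel: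
  assumes "real_orthogonal_mat n Q" "X \<in> carrier_mat n n"
  shows "transpose_mat Q * (Q * X) = X" "Q * (transpose_mat Q * X) = X"
  using real_orthogonal_matD[OF assms(1)] assms(2)
    assoc_mult_mat[of "transpose_mat Q" n n Q n X n, symmetric]
    assoc_mult_mat[of Q n n "transpose_mat Q" n X n, symmetric] by auto

lemma mat_fun_eq:
  assumes "spectral_decomp A Q l"
  shows "mat_fun f A = Q * mat_diag (dim_row A) (\<lambda>i. f (l i)) * transpose_mat Q"
proof -
  define n where "n = dim_row A"
  note assoc = assoc_mult_mat[of _ n n _ n _ n] mult_carrier_mat[of _ n n _ n]
    right_mult_one_mat[of _ n n]
  have *: "R * mat_diag n (\<lambda>i. f (m i)) * transpose_mat R
         = Q * mat_diag n (\<lambda>i. f (l i)) * transpose_mat Q"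
    if R: "spectral_decomp A R m" for R m
  proof -
    have oQ: "real_orthogonal_mat n Q" and oR: "real_orthogonal_mat n R"
      using assms R by (auto simp: spectral_decomp_def n_def)
    note Q = real_orthogonal_matD[OF oQ] and R' = real_orthogonal_matD[OF oR]
    note D = mat_diag_dim[where n = n]
    define P where "P = transpose_mat R * Q"
    have P: "P \<in> carrier_mat n n" using Q R' by (auto simp: P_def)
    note cancel = real_orthogonal_mat_cancel[OF oQ] real_orthogonal_mat_cancel[OF oR]
    have "transpose_mat R * (R * mat_diag n m * transpose_mat R) * Q = mat_diag n m * P"
      using Q R' D unfolding P_def by (simp add: assoc cancel)
    moreover have "transpose_mat R * (Q * mat_diag n l * transpose_mat Q) * Q = P * mat_diag n l"
      using Q R' D unfolding P_def by (simp add: assoc)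
    ultimately have "mat_diag n m * P = P * mat_diag n l"
      using assms R by (simp add: spectral_decomp_def n_def)
    then have e: "m i * P $$ (i, j) = P $$ (i, j) * l j" if "i < n" "j < n" for i j
      using that arg_cong[of _ _ "\<lambda>M. M $$ (i, j)"] P
      by (fastforce simp: mat_diag_mult_left[OF P] mat_diag_mult_right[OF P])
    have "f (m i) * P $$ (i, j) = P $$ (i, j) * f (l j)" if "i < n" "j < n" for i j
      using e[OF that] by (cases "P $$ (i, j) = 0") auto
    then have fP: "mat_diag n (\<lambda>i. f (m i)) * P = P * mat_diag n (\<lambda>i. f (l i))"
      using P by (auto simp: mat_diag_mult_left[OF P] mat_diag_mult_right[OF P])
    have RP: "R * P = Q" and PQ: "P * transpose_mat Q = transpose_mat R"
      using R' Q by (simp_all add: P_def assoc cancel)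
    have "R * mat_diag n (\<lambda>i. f (m i)) * transpose_mat R
        = R * (mat_diag n (\<lambda>i. f (m i)) * P) * transpose_mat Q"
      unfolding PQ[symmetric] using R' Q P D by (simp add: assoc)
    also have "\<dots> = (R * P) * mat_diag n (\<lambda>i. f (l i)) * transpose_mat Q"
      unfolding fP using R' Q P D by (simp add: assoc)
    finally show ?thesis by (simp add: RP)
  qed
  show ?thesis
    unfolding mat_fun_def n_def[symmetric] by (rule the_equality) (use assms * in blast)+
qed

lemma spectral_decomp_psd_nonneg:
  assumes "psd_mat n A" "spectral_decomp A Q l" "i < n"
  shows "0 \<le> l i"
proof -
  have A: "A \<in> carrier_mat n n" and dim: "dim_row A = n"
    using assms by (auto simp: psd_mat_def)
  note assoc = assoc_mult_mat[of _ n n _ n _ n] mult_carrier_mat[of _ n n _ n]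
    right_mult_one_mat[of _ n n]
  have oQ: "real_orthogonal_mat n Q" and AQ: "A = Q * mat_diag n l * transpose_mat Q"
    using assms dim by (auto simp: spectral_decomp_def)
  note Q = real_orthogonal_matD[OF oQ]
  note D = mat_diag_dim[where n = n and f = l]
  have "transpose_mat Q * (A * Q) = mat_diag n l"
    unfolding AQ using Q D by (simp add: assoc real_orthogonal_mat_cancel[OF oQ])
  then have "(transpose_mat Q * (A * Q)) $$ (i, i) = l i"
    using Q D assms(3) by (simp add: mat_diag_def)
  moreover have "(transpose_mat Q * (A * Q)) $$ (i, i) = col Q i \<bullet> (A *\<^sub>v col Q i)"
    using Q A assms(3) by (auto simp: col_mult2[OF A Q(1)])
  moreover have "col Q i \<in> carrier_vec n" using Q by auto
  ultimately show ?thesis using assms(1) by (auto simp: psd_mat_def)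
qed

end

theory Submission
  imports Defs "Jordan_Normal_Form.Spectral_Radius"
begin

text \<open>
  The trace of \<open>f(A)\<^sub>S\<close> is the sum of the diagonal entries of \<open>f(A)\<close> with index in \<open>S\<close>. A uniformly
  random \<open>s\<close>-subset contains a given index with probability \<open>s / n\<close>, so by linearity of
  expectation the expected trace is \<open>s / n\<close> times the full trace, and the factor \<open>n / s\<close> restores
  it. This is \<open>expectation_sum_over_random_subset\<close> applied to the diagonal, via
  \<open>trace_principal_submatrix\<close>.

  The counting presupposes that \<open>f(A)\<close> really is an \<open>n \<times> n\<close> matrix. As \<open>mat_fun\<close> is a definite
  description over all spectral decompositions of \<open>A\<close>, that amounts to the existence of one, which
  is the spectral theorem \<open>symmetric_spectral_decomp\<close>. Its proof goes by deflation: over the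
  complex numbers \<open>A\<close> has an eigenvalue, which symmetry forces to be real, so there is a real unit
  eigenvector \<open>v\<close>. In the basis given by an orthogonal matrix with first column \<open>v\<close>, the matrix
  \<open>A\<close> has first column \<open>e\<close> times the first unit vector, and by symmetry also such a first row. What
  remains is a symmetric block of size smaller by one, to which induction applies.
\<close>

section \<open>Real eigenvalues of real symmetric matrices\<close>

text \<open>
  Moving \<open>A\<close> across the Hermitian product in \<open>(A v) \<bullet>c v\<close> turns \<open>k\<close> into its conjugate; the
  common factor \<open>v \<bullet>c v\<close> is non-zero.
\<close>

lemma eigenvalue_of_symmetric_real:
  fixes A :: "real mat"
  assumes A: "A \<in> carrier_mat n n" and sym: "transpose_mat A = A"
    and k: "eigenvalue (map_mat complex_of_real A) k"
  shows "k \<in> \<real>"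
proof -
  let ?C = "map_mat complex_of_real A"
  have C: "?C \<in> carrier_mat n n" using A by simp
  have symC: "transpose_mat ?C = ?C" using sym by (metis map_mat_transpose)
  obtain v where v: "v \<in> carrier_vec n" "v \<noteq> 0\<^sub>v n" "?C *\<^sub>v v = k \<cdot>\<^sub>v v"
    using k A by (auto simp: eigenvalue_def eigenvector_def)
  have cv: "conjugate v \<in> carrier_vec n" using v(1) by simp
  have "?C *\<^sub>v conjugate v = conjugate (?C *\<^sub>v v)"
    by (rule eq_vecI) (use A v(1) in \<open>auto simp: scalar_prod_def\<close>)
  also have "\<dots> = cnj k \<cdot>\<^sub>v conjugate v"
    unfolding v(3) by (rule eq_vecI) (use v(1) in auto)
  finally have conj: "?C *\<^sub>v conjugate v = cnj k \<cdot>\<^sub>v conjugate v" .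
  have "k * (v \<bullet>c v) = (?C *\<^sub>v v) \<bullet>c v" using v cv by simp
  also have "\<dots> = v \<bullet> (?C *\<^sub>v conjugate v)"
    using transpose_vec_mult_scalar[OF C cv v(1)] by (simp add: symC)
  also have "\<dots> = cnj k * (v \<bullet>c v)" using v cv by (simp add: conj)
  finally have "k = cnj k" using v by simp
  then show ?thesis by (metis Reals_cnj_iff)
qed

text \<open>
  A complex eigenvector need not have real entries. Since the eigenvalue is real, it is a
  root of the characteristic polynomial over the reals, which yields an eigenvector there.
\<close>

lemma symmetric_has_unit_eigenvector:
  fixes A :: "real mat"
  assumes A: "A \<in> carrier_mat n n" and sym: "transpose_mat A = A" and n: "0 < n"
  obtains v :: "real vec" and e where "v \<in> carrier_vec n" "v \<bullet> v = 1" "A *\<^sub>v v = e \<cdot>\<^sub>v v"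
proof -
  let ?C = "map_mat complex_of_real A"
  have C: "?C \<in> carrier_mat n n" using A by simp
  obtain k where k: "eigenvalue ?C k"
    using spectrum_non_empty[OF C n] by (auto simp: spectrum_def)
  obtain e where e: "k = complex_of_real e"
    using eigenvalue_of_symmetric_real[OF A sym k] by (auto elim: Reals_cases)
  have "complex_of_real (poly (char_poly A) e) = 0"
    using k unfolding eigenvalue_root_char_poly[OF C] of_real_hom.char_poly_hom[OF A] e by simp
  then have "eigenvalue A e" by (simp add: eigenvalue_root_char_poly[OF A])
  then obtain w where w: "w \<in> carrier_vec n" "w \<noteq> 0\<^sub>v n" "A *\<^sub>v w = e \<cdot>\<^sub>v w"
    using A by (auto simp: eigenvalue_def eigenvector_def)
  have cw: "conjugate w = w" by (rule eq_vecI) auto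
  have "w \<bullet> w > 0"
    using conjugate_square_greater_0_vec[OF w(1)] w(2) by (simp add: cw)
  then have "1 / sqrt (w \<bullet> w) * (1 / sqrt (w \<bullet> w) * (w \<bullet> w)) = 1"
    by (simp add: field_simps)
  then show thesis
    using w A by (intro that[of "(1 / sqrt (w \<bullet> w)) \<cdot>\<^sub>v w" e])
      (auto simp: mult_mat_vec smult_smult_assoc mult.commute)
qed

section \<open>The spectral theorem for real symmetric matrices\<close>

text \<open>
  The witness is the Householder reflection \<open>I - 2 / (u \<bullet> u) u u\<^sup>T\<close> in the hyperplane orthogonal to
  \<open>u = v - e\<^sub>0\<close>, where \<open>e\<^sub>0\<close> is the first unit vector: as \<open>v\<close> and \<open>e\<^sub>0\<close> have equal length, it
  exchanges them.
\<close>

lemma orthogonal_mat_with_first_column: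
  fixes v :: "real vec"
  assumes v: "v \<in> carrier_vec n" "v \<bullet> v = 1" and n: "0 < n"
  obtains W where "real_orthogonal_mat n W" "col W 0 = v"
proof -
  define u where "u i = v $ i - (if i = 0 then 1 else 0)" for i
  define q where "q = (\<Sum>k = 0..<n. u k * u k)"
  \<comment> \<open>For \<open>v = e\<^sub>0\<close> this is \<open>2 / 0 = 0\<close>, and the reflection degenerates to the identity, as it should.\<close>
  define c where "c = 2 / q"
  define W where "W = mat n n (\<lambda>(i, j). (if i = j then 1 else 0) - c * u i * u j)"
  have "q = (\<Sum>k = 0..<n. v $ k * v $ k - 2 * (if k = 0 then v $ k else 0) + (if k = 0 then 1 else 0))"
    unfolding q_def u_def by (intro sum.cong) (auto simp: algebra_simps)
  also have "\<dots> = 2 - 2 * v $ 0"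
    using v n by (simp add: sum.distrib sum_subtractf sum_distrib_left[symmetric] scalar_prod_def)
  finally have q: "q = - 2 * u 0" by (simp add: u_def)
  have u0: "u i = 0" if "q = 0" "i < n" for i
    using that unfolding q_def by (subst (asm) sum_nonneg_eq_0_iff) auto
  \<comment> \<open>Carrying the factor \<open>u i\<close> makes \<open>c * q = 2\<close> valid in the degenerate case \<open>q = 0\<close> as well.\<close>
  have cq: "c * q * u i = 2 * u i" if "i < n" for i
    using u0[OF _ that] by (auto simp: c_def)
  have "transpose_mat W * W = 1\<^sub>m n"
  proof (rule eq_matI)
    fix i j assume "i < dim_row (1\<^sub>m n)" "j < dim_col (1\<^sub>m n)"
    then have i: "i < n" and j: "j < n" by auto
    have "(transpose_mat W * W) $$ (i, j) = (\<Sum>k = 0..<n.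
        ((if k = i then 1 else 0) - c * u k * u i) * ((if k = j then 1 else 0) - c * u k * u j))"
      using i j by (simp add: W_def scalar_prod_def)
    also have "\<dots> = (\<Sum>k = 0..<n. (if k = i then if i = j then 1 else 0 else 0)
        - (if k = i then c * u k * u j else 0) - (if k = j then c * u k * u i else 0)
        + c * c * u i * u j * (u k * u k))"
      by (intro sum.cong) (auto simp: algebra_simps)
    also have "\<dots> = (if i = j then 1 else 0) - 2 * (c * u i * u j) + c * u j * (c * q * u i)"
      using i j by (simp add: sum.distrib sum_subtractf sum_distrib_left[symmetric] q_def)
    also have "\<dots> = 1\<^sub>m n $$ (i, j)"
      using i j by (simp add: cq)
    finally show "(transpose_mat W * W) $$ (i, j) = 1\<^sub>m n $$ (i, j)" .
  qed (auto simp: W_def)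
  then have "real_orthogonal_mat n W" by (simp add: real_orthogonal_mat_def W_def)
  moreover have "col W 0 = v"
  proof (rule eq_vecI)
    fix i assume "i < dim_vec v"
    then have i: "i < n" using v by simp
    have "c * u i * u 0 = - u i"
      using cq[OF i] unfolding q by (simp add: algebra_simps)
    then show "col W 0 $ i = v $ i" using i n by (simp add: W_def u_def)
  qed (use v in \<open>simp add: W_def\<close>)
  ultimately show thesis by (rule that)
qed

lemma real_orthogonal_mat_mult:
  assumes "real_orthogonal_mat n P" "real_orthogonal_mat n Q"
  shows "real_orthogonal_mat n (P * Q)"
proof -
  note P = real_orthogonal_matD[OF assms(1)] and Q = real_orthogonal_matD[OF assms(2)]
  have "transpose_mat (P * Q) * (P * Q) = transpose_mat Q * (transpose_mat P * (P * Q))"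
    using P Q by (simp add: transpose_mult[OF P(1) Q(1)] assoc_mult_mat[of _ n n _ n _ n]
        mult_carrier_mat[of _ n n _ n])
  then show ?thesis
    using P Q by (simp add: real_orthogonal_mat_def real_orthogonal_mat_cancel[OF assms(1)])
qed

text \<open>
  The next two lemmas undo a deflation step: the first changes the basis back, the second
  prepends the split-off eigenvalue to a decomposition of the remaining block.
\<close>

lemma spectral_decomp_conjugate:
  assumes W: "real_orthogonal_mat n W" and A: "A \<in> carrier_mat n n"
    and B: "spectral_decomp (transpose_mat W * A * W) P l"
  shows "spectral_decomp A (W * P) l"
proof -
  note W' = real_orthogonal_matD[OF W]
  note assoc = assoc_mult_mat[of _ n n _ n _ n] mult_carrier_mat[of _ n n _ n]
    right_mult_one_mat[of _ n n]
  have P: "real_orthogonal_mat n P"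
    and eq: "transpose_mat W * A * W = P * mat_diag n l * transpose_mat P"
    using B W' by (simp_all add: spectral_decomp_def)
  note P' = real_orthogonal_matD[OF P]
  have "A = W * (transpose_mat W * A * W) * transpose_mat W"
    using W' A by (simp add: assoc real_orthogonal_mat_cancel[OF W])
  also have "\<dots> = (W * P) * mat_diag n l * transpose_mat (W * P)"
    unfolding eq using W' P' by (simp add: assoc transpose_mult[OF W'(1) P'(1)])
  finally show ?thesis
    using real_orthogonal_mat_mult[OF W P] carrier_matD(1)[OF A]
    unfolding spectral_decomp_def by metis
qed

lemma spectral_decomp_block:
  fixes C :: "real mat"
  assumes C: "C \<in> carrier_mat m m" and dec: "spectral_decomp C Q l"
  shows "spectral_decomp (four_block_mat (mat_diag 1 (\<lambda>_. e)) (0\<^sub>m 1 m) (0\<^sub>m m 1) C)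
           (four_block_mat (1\<^sub>m 1) (0\<^sub>m 1 m) (0\<^sub>m m 1) Q) (case_nat e l)"
proof -
  let ?P = "four_block_mat (1\<^sub>m 1) (0\<^sub>m 1 m) (0\<^sub>m m 1) Q"
  have oQ: "real_orthogonal_mat m Q" and CQ: "C = Q * mat_diag m l * transpose_mat Q"
    using dec C by (simp_all add: spectral_decomp_def)
  note Q = real_orthogonal_matD[OF oQ]
  have PT: "transpose_mat ?P = four_block_mat (1\<^sub>m 1) (0\<^sub>m 1 m) (0\<^sub>m m 1) (transpose_mat Q)"
    using Q by (subst transpose_four_block_mat[of _ 1 1 _ m _ m]) auto
  note mult = mult_four_block_mat[where ?nr1.0 = 1 and ?n1.0 = 1 and ?n2.0 = m and ?nr2.0 = m
      and ?nc1.0 = 1 and ?nc2.0 = m]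
  have "transpose_mat ?P * ?P = 1\<^sub>m (1 + m)"
    unfolding PT using Q by (subst mult) (auto simp: four_block_one_mat[of 1 m, simplified])
  then have oP: "real_orthogonal_mat (Suc m) ?P"
    using four_block_carrier_mat[of "1\<^sub>m 1" 1 1 Q m m] Q by (simp add: real_orthogonal_mat_def)
  have D: "mat_diag (Suc m) (case_nat e l)
      = four_block_mat (mat_diag 1 (\<lambda>_. e)) (0\<^sub>m 1 m) (0\<^sub>m m 1) (mat_diag m l)"
    by (rule eq_matI) (auto simp: mat_diag_def split: nat.split)
  have DQ: "Q * mat_diag m l \<in> carrier_mat m m"
    using Q by (intro mult_carrier_mat[of _ m m]) auto
  let ?E = "mat_diag 1 (\<lambda>_. e)"
  have E: "?E \<in> carrier_mat 1 1" by (rule mat_diag_dim)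
  have "?P * mat_diag (Suc m) (case_nat e l)
      = four_block_mat ?E (0\<^sub>m 1 m) (0\<^sub>m m 1) (Q * mat_diag m l)"
    unfolding D using Q E DQ mat_diag_dim[of m l]
    by (subst mult) (auto simp: left_mult_one_mat[OF E] right_mult_zero_mat[OF E]
        left_mult_zero_mat[OF mat_diag_dim] right_add_zero_mat[OF E] simp del: One_nat_def)
  also have "\<dots> * transpose_mat ?P = four_block_mat ?E (0\<^sub>m 1 m) (0\<^sub>m m 1) C"
    unfolding PT CQ using Q E DQ mult_carrier_mat[OF DQ Q(2)]
    by (subst mult) (auto simp: right_mult_one_mat[OF E] right_mult_zero_mat[OF E]
        right_mult_zero_mat[OF DQ] right_add_zero_mat[OF E] simp del: One_nat_def)
  finally have "?P * mat_diag (Suc m) (case_nat e l) * transpose_mat ?P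
      = four_block_mat ?E (0\<^sub>m 1 m) (0\<^sub>m m 1) C" .
  then show ?thesis using C oP by (simp add: spectral_decomp_def mat_diag_def)
qed

lemma symmetric_spectral_decomp:
  fixes A :: "real mat"
  assumes "A \<in> carrier_mat n n" "transpose_mat A = A"
  shows "\<exists>Q l. spectral_decomp A Q l"
  using assms
proof (induction n arbitrary: A)
  case 0
  then have "spectral_decomp A (1\<^sub>m 0) (\<lambda>_. 0)"
    by (auto simp: spectral_decomp_def real_orthogonal_mat_def intro!: eq_matI)
  then show ?case by blast
next
  case (Suc m)
  note A = Suc.prems(1) and sym = Suc.prems(2)
  obtain v :: "real vec" and e where v: "v \<in> carrier_vec (Suc m)" "v \<bullet> v = 1" "A *\<^sub>v v = e \<cdot>\<^sub>v v"
    using symmetric_has_unit_eigenvector[OF A sym] by blast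
  obtain W where W: "real_orthogonal_mat (Suc m) W" and Wv: "col W 0 = v"
    using orthogonal_mat_with_first_column[OF v(1,2)] by blast
  note W' = real_orthogonal_matD[OF W]
  define B where "B = transpose_mat W * A * W"
  note assoc = assoc_mult_mat[of _ "Suc m" "Suc m" _ "Suc m" _ "Suc m"]
    mult_carrier_mat[of _ "Suc m" "Suc m" _ "Suc m"]
  note tr = transpose_mult[of _ "Suc m" "Suc m" _ "Suc m"]
  have B: "B \<in> carrier_mat (Suc m) (Suc m)" using W' A by (simp add: B_def assoc)
  have symB: "transpose_mat B = B"
    using W' A by (simp add: B_def assoc tr sym)
  then have symB': "B $$ (i, j) = B $$ (j, i)" if "i < Suc m" "j < Suc m" for i j
    using that B by (metis carrier_matD index_transpose_mat(1))
  have "col B 0 = transpose_mat W *\<^sub>v (A *\<^sub>v col W 0)"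
    using W' A by (simp add: B_def assoc col_mult2[of _ "Suc m" "Suc m" _ "Suc m"])
  also have "\<dots> = e \<cdot>\<^sub>v (transpose_mat W *\<^sub>v col W 0)"
    unfolding Wv v(3) using W' v by (simp add: mult_mat_vec)
  also have "transpose_mat W *\<^sub>v col W 0 = unit_vec (Suc m) 0"
    using W' by (simp add: col_mult2[of _ "Suc m" "Suc m" _ "Suc m", symmetric])
  finally have col: "col B 0 = e \<cdot>\<^sub>v unit_vec (Suc m) 0" .
  have col0: "B $$ (i, 0) = (if i = 0 then e else 0)" if "i < Suc m" for i
  proof -
    have "B $$ (i, 0) = col B 0 $ i" using B that by simp
    then show ?thesis using that by (simp add: col)
  qed
  define C where "C = mat m m (\<lambda>(i, j). B $$ (Suc i, Suc j))"
  have C: "C \<in> carrier_mat m m" by (simp add: C_def)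
  have symC: "transpose_mat C = C"
    by (rule eq_matI) (auto simp: C_def symB')
  have "B = four_block_mat (mat_diag 1 (\<lambda>_. e)) (0\<^sub>m 1 m) (0\<^sub>m m 1) C"
    by (rule eq_matI) (use B col0 symB'[of 0] in \<open>auto simp: mat_diag_def C_def\<close>)
  moreover obtain Q l where "spectral_decomp C Q l" using Suc.IH[OF C symC] by blast
  ultimately show ?case
    using spectral_decomp_block[OF C] spectral_decomp_conjugate[OF W A] unfolding B_def by metis
qed

text \<open>
  Without a spectral decomposition of \<open>A\<close> the description defining \<open>mat_fun f A\<close> would denote
  nothing in particular; this is where the spectral theorem is needed.
\<close>

corollary mat_fun_carrier:
  assumes A: "A \<in> carrier_mat n n" and "transpose_mat A = A"
  shows "mat_fun f A \<in> carrier_mat n n"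
proof -
  obtain Q l where dec: "spectral_decomp A Q l" using symmetric_spectral_decomp[OF assms] by blast
  then have "Q \<in> carrier_mat n n"
    using A by (simp add: spectral_decomp_def real_orthogonal_mat_def)
  then show ?thesis
    using A by (simp add: mat_fun_eq[OF dec] mult_carrier_mat[of _ n n _ n])
qed

section \<open>Uniform sampling of principal submatrices\<close>

text \<open>
  The library enumerates \<open>S\<close> increasingly by \<open>pick S\<close>, so the diagonal of the submatrix is a
  reindexing of the diagonal entries over \<open>S\<close>.
\<close>

lemma trace_principal_submatrix:
  assumes M: "M \<in> carrier_mat n n" and S: "S \<subseteq> {0..<n}"
  shows "trace_mat (submatrix M S S) = (\<Sum>i\<in>S. M $$ (i, i))"
proof -
  have fin: "finite S" using S finite_subset by blast
  have eq: "{i. i < n \<and> i \<in> S} = S" using S by auto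
  have "trace_mat (submatrix M S S) = (\<Sum>k = 0..<card S. M $$ (pick S k, pick S k))"
    using M eq by (simp add: trace_mat_def submatrix_def)
  also have "\<dots> = (\<Sum>i\<in>S. M $$ (i, i))"
  proof (rule sum.reindex_bij_betw)
    have "inj_on (pick S) {0..<card S}"
      by (rule inj_onI) (metis atLeastLessThan_iff card_pick_le)
    moreover have "pick S ` {0..<card S} \<subseteq> S" by (auto intro: pick_in_set_le)
    ultimately show "bij_betw (pick S) {0..<card S} S"
      by (metis bij_betw_def card_atLeastLessThan card_image card_subset_eq diff_zero fin)
  qed
  finally show ?thesis .
qed

lemma card_subsets_containing:
  assumes fin: "finite A" and a: "a \<in> A" and s: "1 \<le> s"
  shows "card {S. S \<subseteq> A \<and> card S = s \<and> a \<in> S} = (card A - 1) choose (s - 1)"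
proof -
  have "bij_betw (insert a) {T. T \<subseteq> A - {a} \<and> card T = s - 1}
      {S. S \<subseteq> A \<and> card S = s \<and> a \<in> S}"
  proof (rule bij_betw_byWitness[where f' = "\<lambda>S. S - {a}"])
    show "insert a ` {T. T \<subseteq> A - {a} \<and> card T = s - 1} \<subseteq> {S. S \<subseteq> A \<and> card S = s \<and> a \<in> S}"
    proof safe
      fix T assume T: "T \<subseteq> A - {a}" "card T = s - 1"
      then have "finite T" "a \<notin> T" using fin finite_subset by auto
      then show "card (insert a T) = s" using T s by simp
    qed (use a in auto)
  qed auto
  then have "card {S. S \<subseteq> A \<and> card S = s \<and> a \<in> S}
      = card {T. T \<subseteq> A - {a} \<and> card T = s - 1}"
    by (rule bij_betw_same_card[symmetric])
  also have "\<dots> = (card A - 1) choose (s - 1)"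
    using fin a by (simp add: n_subsets)
  finally show ?thesis .
qed

text \<open>
  Double counting: \<open>a\<close> lies in \<open>(N - 1) choose (s - 1)\<close> of the \<open>N choose s\<close> subsets of size \<open>s\<close>
  of a set with \<open>N\<close> elements, and the quotient of these numbers is the inclusion probability
  \<open>s / N\<close>.
\<close>

lemma expectation_sum_over_random_subset:
  fixes g :: "'a \<Rightarrow> real"
  assumes fin: "finite A" and s: "1 \<le> s" "s \<le> card A"
  shows "measure_pmf.expectation (pmf_of_set {S. S \<subseteq> A \<and> card S = s}) (\<lambda>S. \<Sum>a\<in>S. g a)
       = real s / real (card A) * (\<Sum>a\<in>A. g a)"
proof -
  let ?F = "{S. S \<subseteq> A \<and> card S = s}"
  have finF: "finite ?F" using fin by simp
  have cF: "card ?F = card A choose s" using fin by (rule n_subsets)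
  then have "card ?F \<noteq> 0" using s by simp
  then have ne: "?F \<noteq> {}" by (metis card.empty)
  \<comment> \<open>Absorption identity for binomial coefficients.\<close>
  have ratio: "real ((card A - 1) choose (s - 1)) / real (card A choose s) = real s / real (card A)"
  proof -
    have "real s * real (card A choose s) = real (card A) * real ((card A - 1) choose (s - 1))"
      using times_binomial_minus1_eq[of s "card A"] s by (metis less_eq_Suc_le One_nat_def of_nat_mult)
    then show ?thesis using s by (simp add: field_simps)
  qed
  have "(\<Sum>S\<in>?F. \<Sum>a\<in>S. g a) = (\<Sum>S\<in>?F. \<Sum>a | a \<in> A \<and> a \<in> S. g a)"
    by (intro sum.cong) (auto intro!: arg_cong[of _ _ "sum g"])
  also have "\<dots> = (\<Sum>a\<in>A. \<Sum>S | S \<in> ?F \<and> a \<in> S. g a)"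
    using finF fin by (rule sum.swap_restrict)
  also have "\<dots> = (\<Sum>a\<in>A. real ((card A - 1) choose (s - 1)) * g a)"
    by (intro sum.cong) (simp_all add: card_subsets_containing[OF fin _ s(1)] conj_assoc)
  finally have "(\<Sum>S\<in>?F. \<Sum>a\<in>S. g a) = real ((card A - 1) choose (s - 1)) * (\<Sum>a\<in>A. g a)"
    by (simp add: sum_distrib_left)
  then show ?thesis
    by (simp add: integral_pmf_of_set[OF ne finF] cF ratio[symmetric])
qed

section \<open>Unbiasedness of the trace estimator\<close>

theorem lemma3p1:
  fixes n s :: nat and A :: "real mat" and f :: "real \<Rightarrow> real"
  assumes "psd_mat n A"
    and "mono_on {0..} f"
    and "1 \<le> s" and "s \<le> n"
  shows "measure_pmf.expectation (pmf_of_set {S. S \<subseteq> {0..<n} \<and> card S = s})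
           (\<lambda>S. real n / real s * trace_mat (submatrix (mat_fun f A) S S))
         = trace_mat (mat_fun f A)"
proof -
  define M where "M = mat_fun f A"
  have M: "M \<in> carrier_mat n n"
    unfolding M_def using assms(1) by (intro mat_fun_carrier) (auto simp: psd_mat_def)
  let ?F = "{S. S \<subseteq> {0..<n} \<and> card S = s}"
  have fin: "finite ?F" by simp
  have "card ?F \<noteq> 0" using n_subsets[of "{0..<n}" s] assms(4) by simp
  then have ne: "?F \<noteq> {}" by (metis card.empty)
  have "measure_pmf.expectation (pmf_of_set ?F)
          (\<lambda>S. real n / real s * trace_mat (submatrix M S S))
      = measure_pmf.expectation (pmf_of_set ?F) (\<lambda>S. real n / real s * (\<Sum>i\<in>S. M $$ (i, i)))"
    by (intro integral_cong_AE)
      (auto simp: AE_measure_pmf_iff set_pmf_of_set[OF ne fin] trace_principal_submatrix[OF M])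
  also have "\<dots> = real n / real s * (real s / real n * (\<Sum>i = 0..<n. M $$ (i, i)))"
    using expectation_sum_over_random_subset[of "{0..<n}" s "\<lambda>i. M $$ (i, i)"] assms(3,4) by simp
  also have "\<dots> = trace_mat M"
    using M assms(3,4) by (simp add: trace_mat_def)
  finally show ?thesis by (simp add: M_def)
qed

end
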